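(* Given a file of size $F>0$, the expected transfer time of a dynamic policy $\pi\in\Pi(F)$ is $$\mathbb{E}[T(\pi,F)]=\Delta\left(\sum_{n=1}^{|\pi|-1}\frac{1}{p_{\pi(F_n)}}+\frac{1-p_{\pi(F_{|\pi|})}}{p_{\pi(F_{|\pi|})}}\right)+\frac{F_{|\pi|}}{r_{\pi(F_{|\pi|})}}.$$
   Context: Let $\mathcal{N}=\{1,\dots,N\}$ be a finite set of channels, $\Delta>0$ a fixed slot duration, and for each $i\in\mathcal{N}$ let $r_i>0$ (rate) and $p_i\in(0,1]$ (availability probability). In each time slot $[k\Delta,(k+1)\Delta)$, $k=0,1,2,\dots$, channel $i$ is available with probability $p_i$, independently over slots and channels. A (deterministic) dynamic policy is a map $\pi:[0,\infty)\to\mathcal{N}$: if the remaining file size at the beginning of a slot is $s>0$, channel $i=\pi(s)$ is sensed. If it is unavailable (probability $1-p_i$), the slot of duration $\Delta$ is wasted and the remaining size stays $s$. If it is available (probability $p_i$; a successful transmission), the remaining size becomes $(s-\Delta r_i)^+=\max\{0,s-\Delta r_i\}$ and the time spent is $\min\{\Delta,s/r_i\}$. The process ends when the remaining size is $0$. $T(\pi,F)$ is the total time spent until then, starting with remaining size $F$, and $\Pi(F)$ is the set of such policies for file size $F$. $|\pi|$ denotes the total number of successful transmissions needed by $\pi$ to transfer the whole file of size $F$, and $F_n$ denotes the remaining file size right before the $n$-th successful transmission: $F_1=F$, $F_n=F_{n-1}-\Delta r_{\pi(F_{n-1})}$ for $n=2,\dots,|\pi|$ (all $F_1,\dots,F_{|\pi|}>0$),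 and after the $|\pi|$-th successful transmission the remaining size is $0$, i.e. $F_{|\pi|}\le\Delta r_{\pi(F_{|\pi|})}$. *)

theory Defs
  imports "HOL-Probability.Probability"
begin

text \<open>Dynamic policies \<open>\<pi> : [0,\<infinity>) \<rightarrow> {1..N}\<close>. The file size \<open>F\<close> does not restrict the set of
  maps, so \<open>\<Pi>(F)\<close> is the same set for every \<open>F\<close>; values of \<open>\<pi>\<close> at negative
  arguments are unconstrained.\<close>

definition policies :: "nat \<Rightarrow> (real \<Rightarrow> nat) set" where
  "policies N = {0..} \<rightarrow> {1..N}"

definition transmit :: "real \<Rightarrow> (nat \<Rightarrow> real) \<Rightarrow> (real \<Rightarrow> nat) \<Rightarrow> real \<Rightarrow> real" where
  "transmit \<Delta> r \<pi> s = max 0 (s - \<Delta> * r (\<pi> s))"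

text \<open>\<open>A k i \<omega>\<close> says that channel \<open>i\<close> is available in slot \<open>k\<close>. Once the size is \<open>0\<close>, it stays \<open>0\<close>
  and no more time is spent.\<close>

primrec remaining :: "real \<Rightarrow> (nat \<Rightarrow> real) \<Rightarrow> (nat \<Rightarrow> nat \<Rightarrow> 'w \<Rightarrow> bool) \<Rightarrow> (real \<Rightarrow> nat) \<Rightarrow> real
    \<Rightarrow> nat \<Rightarrow> 'w \<Rightarrow> real" where
  "remaining \<Delta> r A \<pi> F 0 \<omega> = F"
| "remaining \<Delta> r A \<pi> F (Suc k) \<omega> =
    (let s = remaining \<Delta> r A \<pi> F k \<omega>
     in if s > 0 \<and> A k (\<pi> s) \<omega> then transmit \<Delta> r \<pi> s else s)"

definition slot_time :: "real \<Rightarrow> (nat \<Rightarrow> real) \<Rightarrow> (nat \<Rightarrow> nat \<Rightarrow> 'w \<Rightarrow> bool) \<Rightarrow> (real \<Rightarrow> nat) \<Rightarrow> real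
    \<Rightarrow> nat \<Rightarrow> 'w \<Rightarrow> real" where
  "slot_time \<Delta> r A \<pi> F k \<omega> =
    (let s = remaining \<Delta> r A \<pi> F k \<omega>
     in if s > 0 then (if A k (\<pi> s) \<omega> then min \<Delta> (s / r (\<pi> s)) else \<Delta>) else 0)"

text \<open>The transfer time is extended-valued: it is \<open>\<infinity>\<close> on those outcomes where the transfer never
  completes.\<close>

definition transfer_time :: "real \<Rightarrow> (nat \<Rightarrow> real) \<Rightarrow> (nat \<Rightarrow> nat \<Rightarrow> 'w \<Rightarrow> bool) \<Rightarrow> (real \<Rightarrow> nat)
    \<Rightarrow> real \<Rightarrow> 'w \<Rightarrow> ennreal" where
  "transfer_time \<Delta> r A \<pi> F \<omega> = (\<Sum>k. ennreal (slot_time \<Delta> r A \<pi> F k \<omega>))"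

text \<open>\<open>|\<pi>|\<close>; the set under \<open>LEAST\<close> is nonempty by \<open>ex_transmit_zero\<close> below.\<close>

definition num_transmissions :: "real \<Rightarrow> (nat \<Rightarrow> real) \<Rightarrow> (real \<Rightarrow> nat) \<Rightarrow> real \<Rightarrow> nat" where
  "num_transmissions \<Delta> r \<pi> F = (LEAST n. (transmit \<Delta> r \<pi> ^^ n) F = 0)"

text \<open>\<open>F\<^sub>n\<close>, indexed from \<open>1\<close>; meaningful only for \<open>1 \<le> n \<le> |\<pi>|\<close>.\<close>

definition size_before :: "real \<Rightarrow> (nat \<Rightarrow> real) \<Rightarrow> (real \<Rightarrow> nat) \<Rightarrow> real \<Rightarrow> nat \<Rightarrow> real" where
  "size_before \<Delta> r \<pi> F n = ((\<lambda>s. s - \<Delta> * r (\<pi> s)) ^^ (n - 1)) F"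

lemma size_before_1: "size_before \<Delta> r \<pi> F 1 = F"
  by (simp add: size_before_def)

lemma size_before_rec:
  assumes "n \<ge> 2"
  shows "size_before \<Delta> r \<pi> F n =
    size_before \<Delta> r \<pi> F (n - 1) - \<Delta> * r (\<pi> (size_before \<Delta> r \<pi> F (n - 1)))"
proof -
  obtain m where "n = Suc (Suc m)"
    using assms by (metis Suc_le_D numeral_2_eq_2 Suc_le_mono)
  then show ?thesis by (simp add: size_before_def)
qed

lemma transmit_funpow_nonneg: "0 \<le> F \<Longrightarrow> 0 \<le> (transmit \<Delta> r \<pi> ^^ n) F"
  by (cases n) (auto simp: transmit_def)

lemma ex_transmit_zero:
  assumes "\<Delta> > 0" "\<And>i. i \<in> {1..N} \<Longrightarrow> r i > 0" "\<pi> \<in> policies N" "F > 0"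
  shows "\<exists>n. (transmit \<Delta> r \<pi> ^^ n) F = 0"
proof -
  have "\<pi> 0 \<in> {1..N}"
    using assms(3) by (auto simp: policies_def)
  then have ne: "r ` {1..N} \<noteq> {}" by auto
  define c where "c = Min (r ` {1..N})"
  have c: "c > 0" "\<And>i. i \<in> {1..N} \<Longrightarrow> c \<le> r i"
    using ne assms(2) by (auto simp: c_def)
  have bound: "(transmit \<Delta> r \<pi> ^^ n) F \<le> max 0 (F - real n * (\<Delta> * c))" for n
  proof (induction n)
    case 0
    then show ?case by simp
  next
    case (Suc n)
    let ?s = "(transmit \<Delta> r \<pi> ^^ n) F"
    have "\<pi> ?s \<in> {1..N}"
      using assms(3,4) transmit_funpow_nonneg[of F] by (auto simp: policies_def Pi_iff)
    then have "\<Delta> * c \<le> \<Delta> * r (\<pi> ?s)"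
      using c assms(1) by (intro mult_left_mono) auto
    moreover have "0 < \<Delta> * c" using c assms(1) by simp
    ultimately have "max 0 (?s - \<Delta> * r (\<pi> ?s)) \<le> max 0 (F - real n * (\<Delta> * c) - \<Delta> * c)"
      using Suc by linarith
    moreover have "F - real (Suc n) * (\<Delta> * c) = F - real n * (\<Delta> * c) - \<Delta> * c"
      by (simp add: algebra_simps)
    moreover have "(transmit \<Delta> r \<pi> ^^ Suc n) F = max 0 (?s - \<Delta> * r (\<pi> ?s))"
      by (simp add: transmit_def[of _ _ _ ?s])
    ultimately show ?case by simp
  qed
  obtain n where "F < real n * (\<Delta> * c)"
    using ex_less_of_nat_mult[of "\<Delta> * c" F] c assms(1) by auto
  then have "(transmit \<Delta> r \<pi> ^^ n) F = 0"
    using bound[of n] transmit_funpow_nonneg[of F n \<Delta> r \<pi>] assms(4) by (auto simp: max_def split: if_splits)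
  then show ?thesis ..
qed

lemma size_before_eq_transmit:
  assumes "F > 0" "n < num_transmissions \<Delta> r \<pi> F"
  shows "size_before \<Delta> r \<pi> F (Suc n) = (transmit \<Delta> r \<pi> ^^ n) F"
    and "size_before \<Delta> r \<pi> F (Suc n) > 0"
proof -
  have nz: "(transmit \<Delta> r \<pi> ^^ m) F \<noteq> 0" if "m \<le> n" for m
    using that assms(2) not_less_Least unfolding num_transmissions_def
    by (metis (mono_tags, lifting) le_less_trans)
  have "m \<le> n \<Longrightarrow> size_before \<Delta> r \<pi> F (Suc m) = (transmit \<Delta> r \<pi> ^^ m) F" for m
  proof (induction m)
    case (Suc m)
    let ?s = "(transmit \<Delta> r \<pi> ^^ m) F"
    have "(transmit \<Delta> r \<pi> ^^ Suc m) F = max 0 (?s - \<Delta> * r (\<pi> ?s))"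
      by (simp add: transmit_def[of _ _ _ ?s])
    moreover have "size_before \<Delta> r \<pi> F (Suc (Suc m)) = ?s - \<Delta> * r (\<pi> ?s)"
      using Suc by (simp add: size_before_def)
    ultimately show ?case
      using nz[OF Suc.prems] by linarith
  qed (simp add: size_before_def)
  then show *: "size_before \<Delta> r \<pi> F (Suc n) = (transmit \<Delta> r \<pi> ^^ n) F" by simp
  show "size_before \<Delta> r \<pi> F (Suc n) > 0"
    using nz[of n] transmit_funpow_nonneg[of F n \<Delta> r \<pi>] assms(1) unfolding * by simp
qed

lemma remaining_in_orbit:
  "remaining \<Delta> r A \<pi> F k \<omega> \<in> range (\<lambda>n. (transmit \<Delta> r \<pi> ^^ n) F)"
proof (induction k)
  case 0
  show ?case by (auto intro: range_eqI[of _ _ 0])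
next
  case (Suc k)
  then obtain n where "remaining \<Delta> r A \<pi> F k \<omega> = (transmit \<Delta> r \<pi> ^^ n) F" by blast
  then show ?case
    by (auto simp: Let_def intro: range_eqI[of _ _ n] range_eqI[of _ _ "Suc n"])
qed

text \<open>No measurability of \<open>\<pi>\<close> is needed, since only countably many sizes are reachable.\<close>

lemma transfer_time_measurable:
  assumes A: "\<And>k i. i \<in> {1..N} \<Longrightarrow> A k i \<in> measurable M (count_space UNIV)"
    and pi: "\<pi> \<in> policies N" and F: "F > 0"
  shows "transfer_time \<Delta> r A \<pi> F \<in> borel_measurable M"
proof -
  define C where "C = range (\<lambda>n. (transmit \<Delta> r \<pi> ^^ n) F)"
  have C: "countable C" by (simp add: C_def)
  have pC: "\<pi> s \<in> {1..N}" if "s \<in> C" for s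
    using that pi transmit_funpow_nonneg[of F] F by (auto simp: C_def policies_def Pi_iff)
  have tC: "transmit \<Delta> r \<pi> s \<in> C" if sC: "s \<in> C" for s
  proof -
    obtain n where n: "s = (transmit \<Delta> r \<pi> ^^ n) F" using sC unfolding C_def by blast
    show ?thesis unfolding C_def by (rule range_eqI[of _ _ "Suc n"]) (simp add: n)
  qed
  have rem: "remaining \<Delta> r A \<pi> F k \<in> measurable M (count_space C)" for k
  proof (induction k)
    case 0
    have "F \<in> C" using remaining_in_orbit[of \<Delta> r A \<pi> F 0] by (simp add: C_def)
    then show ?case by simp
  next
    case (Suc k)
    have "(\<lambda>\<omega>. (\<lambda>s \<omega>. if s > 0 \<and> A k (\<pi> s) \<omega> then transmit \<Delta> r \<pi> s else s)
            (remaining \<Delta> r A \<pi> F k \<omega>) \<omega>) \<in> measurable M (count_space C)"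
    proof (rule measurable_compose_countable'[OF _ Suc C])
      fix s assume s: "s \<in> C"
      have [measurable]: "A k (\<pi> s) \<in> measurable M (count_space UNIV)"
        using A pC[OF s] by blast
      show "(\<lambda>\<omega>. if s > 0 \<and> A k (\<pi> s) \<omega> then transmit \<Delta> r \<pi> s else s) \<in> measurable M (count_space C)"
        using s tC[OF s] by (intro measurable_If) auto
    qed
    then show ?case by (simp add: Let_def cong: measurable_cong)
  qed
  have "slot_time \<Delta> r A \<pi> F k \<in> borel_measurable M" for k
  proof -
    have "(\<lambda>\<omega>. (\<lambda>s \<omega>. if s > 0 then (if A k (\<pi> s) \<omega> then min \<Delta> (s / r (\<pi> s)) else \<Delta>) else 0)
            (remaining \<Delta> r A \<pi> F k \<omega>) \<omega>) \<in> borel_measurable M"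
    proof (rule measurable_compose_countable'[OF _ rem C])
      fix s assume s: "s \<in> C"
      have [measurable]: "A k (\<pi> s) \<in> measurable M (count_space UNIV)"
        using A pC[OF s] by blast
      show "(\<lambda>\<omega>. if s > 0 then (if A k (\<pi> s) \<omega> then min \<Delta> (s / r (\<pi> s)) else \<Delta>) else 0)
          \<in> borel_measurable M"
        by measurable
    qed
    then show ?thesis by (simp add: slot_time_def Let_def cong: measurable_cong)
  qed
  then show ?thesis
    unfolding transfer_time_def by measurable
qed

end

theory Submission
  imports Defs
begin

text \<open>
  Failed slots do not change the remaining size, so the sizes that occur form the deterministic
  sequence \<open>F = s\<^sub>0 > s\<^sub>1 > \<dots> > s\<^sub>m = 0\<close> obtained by always transmitting successfully; chance
  only decides how long the transfer stays at each of them. With the slot as the unit of time,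
  the remaining size is a chain that moves from \<open>s\<^sub>n\<close> to \<open>s\<^sub>n\<^sub>+\<^sub>1\<close> with probability
  \<open>p (\<pi> s\<^sub>n)\<close> and otherwise stays, because the size at the start of slot \<open>k\<close> is determined by
  the availabilities in earlier slots and hence is independent of those in slot \<open>k\<close>
  (\<open>prob_at_stage_available\<close>).

  The expected time is computed by counting visits. In a slot that starts with size
  \<open>s\<^sub>n > 0\<close>, the mean time spent depends on \<open>n\<close> alone, so the mean total time is
  the sum over \<open>n\<close> of this cost times the mean number \<open>\<Sum>k. P(size in slot k is s\<^sub>n)\<close> of slots
  that start with size \<open>s\<^sub>n\<close>. That number is \<open>1 / p (\<pi> s\<^sub>n)\<close>: in expectation the chain leaves
  \<open>s\<^sub>n\<close> exactly as often as it enters it, and it enters exactly once (\<open>prob_at_stage_sums\<close>).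
  For \<open>n < m - 1\<close> every slot costs the full \<open>\<Delta>\<close>, giving \<open>\<Delta> / p\<close>; at the last size the
  successful slot is cut short after time \<open>s / r\<close>, giving \<open>s / r + \<Delta> (1 - p) / p\<close>.
\<close>

section \<open>A geometric recurrence\<close>

text \<open>
  The equation obtained by summing the recurrence over all \<open>k\<close> determines the sum only when the
  series converges; convergence holds since the same computation bounds the partial sums.
\<close>

lemma affine_recurrence_sums:
  fixes f g :: "nat \<Rightarrow> real"
  assumes f: "\<And>k. f k \<ge> 0" and g: "\<And>k. g k \<ge> 0" "g sums S" and q: "q > 0"
    and rec: "\<And>k. f (Suc k) = (1 - q) * f k + g k"
  shows "f sums ((f 0 + S) / q)"
proof -
  have telescope: "q * (\<Sum>k<K. f k) = f 0 - f K + (\<Sum>k<K. g k)" for K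
    by (induction K) (simp_all add: rec algebra_simps)
  have "(\<Sum>k<K. f k) \<le> (f 0 + S) / q" for K
  proof -
    have "(\<Sum>k<K. g k) \<le> S"
      using g sum_le_suminf[of g "{..<K}"] by (simp add: sums_iff)
    then have "q * (\<Sum>k<K. f k) \<le> f 0 + S"
      using telescope[of K] f[of K] by linarith
    then show ?thesis using q by (simp add: field_simps)
  qed
  then have "summable f"
    by (intro summableI_nonneg_bounded[where x = "(f 0 + S) / q"] f)
  then have f_sums: "f sums suminf f"
    by blast
  have "(\<lambda>k. f (Suc k)) sums ((1 - q) * suminf f + S)"
    unfolding rec by (intro sums_add sums_mult f_sums g)
  then have "f sums ((1 - q) * suminf f + S + f 0)"
    by (rule sums_Suc)
  then have "suminf f = (1 - q) * suminf f + S + f 0"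
    using f_sums sums_unique2 by blast
  then have "suminf f = (f 0 + S) / q"
    using q by (simp add: field_simps)
  then show ?thesis using f_sums by simp
qed

section \<open>The deterministic sequence of sizes\<close>

locale file_transfer =
  fixes \<Delta> F :: real and r :: "nat \<Rightarrow> real" and \<pi> :: "real \<Rightarrow> nat" and N :: nat
  assumes slot_pos: "\<Delta> > 0" and rate_pos: "\<And>i. i \<in> {1..N} \<Longrightarrow> r i > 0"
    and file_pos: "F > 0" and policy: "\<pi> \<in> policies N"
begin

definition stage :: "nat \<Rightarrow> real" where
  "stage n = (transmit \<Delta> r \<pi> ^^ n) F"

definition channel :: "nat \<Rightarrow> nat" where
  "channel n = \<pi> (stage n)"

abbreviation m :: nat where
  "m \<equiv> num_transmissions \<Delta> r \<pi> F"

lemma stage_0: "stage 0 = F"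
  by (simp add: stage_def)

lemma stage_Suc: "stage (Suc n) = max 0 (stage n - \<Delta> * r (channel n))"
  by (simp add: stage_def channel_def transmit_def)

lemma stage_m: "stage m = 0"
  unfolding stage_def num_transmissions_def
  using ex_transmit_zero[OF slot_pos rate_pos policy file_pos] by (rule LeastI_ex)

lemma stage_pos: "n < m \<Longrightarrow> stage n > 0"
  using size_before_eq_transmit[OF file_pos, of n \<Delta> r \<pi>] by (simp add: stage_def)

lemma m_pos: "m > 0"
  using stage_m stage_0 file_pos by (cases m) auto

lemma channel_in: "channel n \<in> {1..N}"
  using policy transmit_funpow_nonneg[of F n \<Delta> r \<pi>] file_pos
  by (auto simp: channel_def stage_def policies_def Pi_iff)

lemma channel_rate: "r (channel n) > 0"
  using rate_pos channel_in by blast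

lemma stage_Suc_less: "n < m \<Longrightarrow> stage (Suc n) < stage n"
  using stage_pos[of n] channel_rate[of n] slot_pos by (simp add: stage_Suc)

lemma stage_less:
  assumes "n < n'" "n' \<le> m"
  shows "stage n' < stage n"
  using assms
proof (induction n' rule: less_induct)
  case (less n')
  then obtain j where j: "n' = Suc j" by (cases n') auto
  then have "stage n' < stage j" using less.prems stage_Suc_less by simp
  moreover have "stage j \<le> stage n"
    using less j by (cases "n = j") (auto intro: less_imp_le)
  ultimately show ?case by simp
qed

lemma stage_eq_iff: "n \<le> m \<Longrightarrow> n' \<le> m \<Longrightarrow> stage n = stage n' \<longleftrightarrow> n = n'"
  using stage_less[of n n'] stage_less[of n' n] by (cases n n' rule: linorder_cases) auto

lemma stage_before_last: "Suc n < m \<Longrightarrow> \<Delta> * r (channel n) < stage n"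
  using stage_pos[of "Suc n"] by (simp add: stage_Suc)

lemma stage_last: "stage (m - 1) \<le> \<Delta> * r (channel (m - 1))"
  using stage_m stage_Suc[of "m - 1"] m_pos by simp

section \<open>The remaining size as a walk along this sequence\<close>

lemma remaining_cases:
  obtains n where "n \<le> m" "remaining \<Delta> r A \<pi> F k \<omega> = stage n"
proof -
  have "\<exists>n\<le>m. remaining \<Delta> r A \<pi> F k \<omega> = stage n"
  proof (induction k)
    case 0
    show ?case by (intro exI[of _ 0]) (simp add: stage_0)
  next
    case (Suc k)
    then obtain n where n: "n \<le> m" "remaining \<Delta> r A \<pi> F k \<omega> = stage n" by blast
    show ?case
    proof (cases "n < m \<and> A k (\<pi> (stage n)) \<omega>")
      case True
      then show ?thesis using n stage_pos[of n]
        by (intro exI[of _ "Suc n"]) (simp add: stage_def)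
    next
      case False
      then have "stage n = 0 \<or> \<not> A k (\<pi> (stage n)) \<omega>"
        using n stage_m by (cases "n = m") auto
      then show ?thesis using n by (intro exI[of _ n]) auto
    qed
  qed
  then show ?thesis using that by blast
qed

text \<open>
  The availabilities are a parameter of arbitrary domain because independence is proved by
  evaluating this predicate both on the given space and on a product of copies of \<open>bool\<close>.
\<close>

definition at_stage :: "(nat \<Rightarrow> nat \<Rightarrow> 'w \<Rightarrow> bool) \<Rightarrow> nat \<Rightarrow> nat \<Rightarrow> 'w \<Rightarrow> bool" where
  "at_stage A k n \<omega> \<longleftrightarrow> remaining \<Delta> r A \<pi> F k \<omega> = stage n"

lemma at_stage_init: "n \<le> m \<Longrightarrow> at_stage A 0 n \<omega> \<longleftrightarrow> n = 0"
  using stage_eq_iff[of n 0] by (auto simp: at_stage_def stage_0)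

lemma remaining_Suc_at_stage:
  assumes "n < m" "at_stage A k n \<omega>"
  shows "remaining \<Delta> r A \<pi> F (Suc k) \<omega> =
    stage (if A k (channel n) \<omega> then Suc n else n)"
  using assms stage_pos[of n] by (simp add: at_stage_def channel_def stage_def)

lemma remaining_Suc_at_end:
  assumes "at_stage A k m \<omega>"
  shows "remaining \<Delta> r A \<pi> F (Suc k) \<omega> = stage m"
  using assms by (simp add: at_stage_def stage_m)

text \<open>
  The sizes \<open>s\<^sub>0, \<dots>, s\<^sub>m\<close> are distinct, so the current size identifies how many transmissions
  have succeeded, and \<open>s\<^sub>n\<close> can be reached only by waiting or from \<open>s\<^sub>n\<^sub>-\<^sub>1\<close>.
\<close>

lemma at_stage_step:
  assumes n: "n < m"
  shows "at_stage A (Suc k) n \<omega> \<longleftrightarrow>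
    at_stage A k n \<omega> \<and> \<not> A k (channel n) \<omega> \<or>
    (\<exists>j. n = Suc j \<and> at_stage A k j \<omega> \<and> A k (channel j) \<omega>)"
proof -
  obtain l where l: "l \<le> m" "remaining \<Delta> r A \<pi> F k \<omega> = stage l"
    by (rule remaining_cases)
  then have at_l: "at_stage A k j \<omega> \<longleftrightarrow> j = l" if "j \<le> m" for j
    using that by (auto simp: at_stage_def stage_eq_iff)
  show ?thesis
  proof (cases "l < m")
    case True
    then show ?thesis
      using n at_l remaining_Suc_at_stage[OF True, of A k \<omega>]
      by (auto simp: at_stage_def[of A "Suc k"] stage_eq_iff)
  next
    case False
    then have "l = m" using l by simp
    then show ?thesis
      using n at_l remaining_Suc_at_end[of A k \<omega>]
      by (auto simp: at_stage_def[of A "Suc k"] stage_eq_iff)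
  qed
qed

lemma slot_time_eq_sum:
  "slot_time \<Delta> r A \<pi> F k \<omega> =
    (\<Sum>n<m. if at_stage A k n \<omega>
      then if A k (channel n) \<omega> then min \<Delta> (stage n / r (channel n)) else \<Delta> else 0)"
proof -
  obtain l where l: "l \<le> m" "remaining \<Delta> r A \<pi> F k \<omega> = stage l"
    by (rule remaining_cases)
  then have at_l: "at_stage A k j \<omega> \<longleftrightarrow> j = l" if "j < m" for j
    using that by (auto simp: at_stage_def stage_eq_iff)
  have "(\<Sum>n<m. if at_stage A k n \<omega>
      then if A k (channel n) \<omega> then min \<Delta> (stage n / r (channel n)) else \<Delta> else 0) =
    (\<Sum>n<m. if n = l
      then if A k (channel n) \<omega> then min \<Delta> (stage n / r (channel n)) else \<Delta> else 0)"
    by (intro sum.cong) (auto simp: at_l)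
  also have "\<dots> = slot_time \<Delta> r A \<pi> F k \<omega>"
    using l stage_pos[of l] stage_m
    by (cases "l = m") (auto simp: slot_time_def channel_def Let_def)
  finally show ?thesis ..
qed

lemma at_stage_measurable:
  assumes "\<And>j i. j < k \<Longrightarrow> i \<in> {1..N} \<Longrightarrow> Measurable.pred Q (A j i)" "n < m"
  shows "Measurable.pred Q (at_stage A k n)"
  using assms
proof (induction k arbitrary: n)
  case 0
  then show ?case by (simp add: at_stage_init cong: measurable_cong)
next
  case (Suc k)
  have [measurable]: "Measurable.pred Q (at_stage A k j)" if "j < m" for j
    using Suc that by simp
  have [measurable]: "Measurable.pred Q (A k (channel j))" for j
    using Suc.prems(1) channel_in by blast
  have "Measurable.pred Q (\<lambda>\<omega>. at_stage A k n \<omega> \<and> \<not> A k (channel n) \<omega> \<or>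
      (\<exists>j. n = Suc j \<and> at_stage A k j \<omega> \<and> A k (channel j) \<omega>))"
    using Suc.prems(2) by (cases n) simp_all
  then show ?case
    by (rule measurable_cong[THEN iffD2, rotated]) (rule at_stage_step[OF Suc.prems(2)])
qed

lemma at_stage_cong:
  assumes "\<And>j i. j < k \<Longrightarrow> i \<in> {1..N} \<Longrightarrow> A j i \<omega> \<longleftrightarrow> B j i \<omega>'" "n < m"
  shows "at_stage A k n \<omega> \<longleftrightarrow> at_stage B k n \<omega>'"
  using assms
proof (induction k arbitrary: n)
  case 0
  then show ?case by (simp add: at_stage_init)
next
  case (Suc k)
  have "at_stage A k j \<omega> \<longleftrightarrow> at_stage B k j \<omega>'" if "j < m" for j
    using Suc that by simp
  moreover have "A k (channel j) \<omega> \<longleftrightarrow> B k (channel j) \<omega>'" for j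
    using Suc.prems(1) channel_in by blast
  ultimately show ?case
    using Suc.prems(2) unfolding at_stage_step[OF Suc.prems(2)] by (cases n) simp_all
qed

end

section \<open>Expected number of slots spent at each size\<close>

locale random_file_transfer = file_transfer \<Delta> F r \<pi> N + prob_space M
  for \<Delta> F r \<pi> N and M :: "'w measure" +
  fixes p :: "nat \<Rightarrow> real" and A :: "nat \<Rightarrow> nat \<Rightarrow> 'w \<Rightarrow> bool"
  assumes p_pos: "\<And>i. i \<in> {1..N} \<Longrightarrow> 0 < p i" and p_le_1: "\<And>i. i \<in> {1..N} \<Longrightarrow> p i \<le> 1"
    and indep: "indep_vars (\<lambda>_. count_space UNIV) (\<lambda>(k, i). A k i) (UNIV \<times> {1..N})"
    and prob_available: "\<And>k i. i \<in> {1..N} \<Longrightarrow> prob {\<omega> \<in> space M. A k i \<omega>} = p i"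
begin

lemma available_measurable: "i \<in> {1..N} \<Longrightarrow> Measurable.pred M (A k i)"
  using indep by (auto simp: indep_vars_def)

lemma channel_available_measurable [measurable]: "Measurable.pred M (A k (channel n))"
  using available_measurable channel_in by blast

lemma at_stage_measurable_M [measurable]: "n < m \<Longrightarrow> Measurable.pred M (at_stage A k n)"
  by (intro at_stage_measurable available_measurable)

definition visit_prob :: "nat \<Rightarrow> nat \<Rightarrow> real" where
  "visit_prob k n = prob {\<omega> \<in> space M. at_stage A k n \<omega>}"

text \<open>
  The size at the start of slot \<open>k\<close> is a function of the family of availabilities in the slots
  before \<open>k\<close>. To use independence of families, this function is written down on the product space
  of those availabilities, where it is the same recursion run on the coordinate predicates.
\<close>

lemma prob_at_stage_available:
  assumes n: "n < m"
  shows "prob {\<omega> \<in> space M. at_stage A k n \<omega> \<and> A k (channel n) \<omega>} =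
    visit_prob k n * p (channel n)"
proof -
  define past where "past = {..<k} \<times> {1..N}"
  define now where "now = {(k, channel n)}"
  let ?P = "\<lambda>I :: (nat \<times> nat) set. PiM I (\<lambda>_. count_space (UNIV :: bool set))"
  let ?X = "\<lambda>I \<omega>. restrict (\<lambda>ji. (case ji of (j, i) \<Rightarrow> A j i) \<omega>) I"
  let ?coord = "\<lambda>j i (x :: nat \<times> nat \<Rightarrow> bool). x (j, i)"
  let ?Ea = "{x \<in> space (?P past). at_stage ?coord k n x}"
  let ?Eb = "{x \<in> space (?P now). x (k, channel n)}"
  have "indep_var (?P past) (?X past) (?P now) (?X now)"
    by (rule indep_var_restrict[OF indep])
       (use channel_in[of n] in \<open>auto simp: past_def now_def\<close>)
  moreover have "?Ea \<in> sets (?P past)"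
  proof -
    have "Measurable.pred (?P past) (at_stage ?coord k n)"
      by (rule at_stage_measurable[OF _ n])
         (auto simp: past_def intro!: measurable_component_singleton)
    then show ?thesis by measurable
  qed
  moreover have "?Eb \<in> sets (?P now)"
  proof -
    have "Measurable.pred (?P now) (\<lambda>x. x (k, channel n))"
      by (auto simp: now_def intro!: measurable_component_singleton)
    then show ?thesis by measurable
  qed
  ultimately have
    "prob ((\<lambda>\<omega>. (?X past \<omega>, ?X now \<omega>)) -` (?Ea \<times> ?Eb) \<inter> space M) =
      prob (?X past -` ?Ea \<inter> space M) * prob (?X now -` ?Eb \<inter> space M)"
    by (rule indep_varD)
  moreover have past_iff: "?X past \<omega> \<in> ?Ea \<longleftrightarrow> at_stage A k n \<omega>" for \<omega>
  proof -
    have "at_stage ?coord k n (?X past \<omega>) \<longleftrightarrow> at_stage A k n \<omega>"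
      by (rule at_stage_cong[OF _ n]) (simp add: past_def)
    then show ?thesis by (simp add: space_PiM)
  qed
  moreover have now_iff: "?X now \<omega> \<in> ?Eb \<longleftrightarrow> A k (channel n) \<omega>" for \<omega>
    by (simp add: now_def space_PiM)
  ultimately have "prob {\<omega> \<in> space M. at_stage A k n \<omega> \<and> A k (channel n) \<omega>} =
      prob {\<omega> \<in> space M. at_stage A k n \<omega>} * prob {\<omega> \<in> space M. A k (channel n) \<omega>}"
    by (simp only: vimage_def mem_Times_iff fst_conv snd_conv Int_def mem_Collect_eq conj_commute)
  then show ?thesis
    using channel_in by (simp add: visit_prob_def prob_available)
qed

lemma prob_at_stage_unavailable:
  assumes n: "n < m"
  shows "prob {\<omega> \<in> space M. at_stage A k n \<omega> \<and> \<not> A k (channel n) \<omega>} =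
    visit_prob k n * (1 - p (channel n))"
proof -
  have "prob ({\<omega> \<in> space M. at_stage A k n \<omega>} -
      {\<omega> \<in> space M. at_stage A k n \<omega> \<and> A k (channel n) \<omega>}) =
    visit_prob k n - visit_prob k n * p (channel n)"
    using n unfolding visit_prob_def prob_at_stage_available[OF n, unfolded visit_prob_def, symmetric]
    by (intro finite_measure_Diff) auto
  also have "{\<omega> \<in> space M. at_stage A k n \<omega>} -
      {\<omega> \<in> space M. at_stage A k n \<omega> \<and> A k (channel n) \<omega>} =
    {\<omega> \<in> space M. at_stage A k n \<omega> \<and> \<not> A k (channel n) \<omega>}"
    by blast
  finally show ?thesis by (simp add: algebra_simps)
qed

lemma visit_prob_init: "n < m \<Longrightarrow> visit_prob 0 n = (if n = 0 then 1 else 0)"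
  using prob_space by (simp add: visit_prob_def at_stage_init)

lemma visit_prob_step:
  assumes n: "n < m"
  shows "visit_prob (Suc k) n = (1 - p (channel n)) * visit_prob k n +
    (case n of 0 \<Rightarrow> 0 | Suc j \<Rightarrow> visit_prob k j * p (channel j))"
proof (cases n)
  case 0
  then show ?thesis
    using n prob_at_stage_unavailable[OF n, of k]
    by (simp add: visit_prob_def[of "Suc k"] at_stage_step mult.commute)
next
  case (Suc j)
  let ?stay = "{\<omega> \<in> space M. at_stage A k n \<omega> \<and> \<not> A k (channel n) \<omega>}"
  let ?move = "{\<omega> \<in> space M. at_stage A k j \<omega> \<and> A k (channel j) \<omega>}"
  have j: "j < m" using n Suc by simp
  have "\<not> (at_stage A k n \<omega> \<and> at_stage A k j \<omega>)" for \<omega>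
    using n Suc stage_eq_iff[of n j] by (auto simp: at_stage_def)
  then have "?stay \<inter> ?move = {}" by blast
  then have "prob (?stay \<union> ?move) = prob ?stay + prob ?move"
    using n j by (intro finite_measure_Union) auto
  moreover have "{\<omega> \<in> space M. at_stage A (Suc k) n \<omega>} = ?stay \<union> ?move"
    using at_stage_step[OF n, of A k] Suc by auto
  ultimately show ?thesis
    using Suc prob_at_stage_unavailable[OF n, of k] prob_at_stage_available[OF j, of k]
    by (simp add: visit_prob_def[of "Suc k"] mult.commute)
qed

text \<open>
  A geometric number of slots is spent at each size. For a size after the first, the inflow
  \<open>visit_prob k j * p (channel j)\<close> summed over all slots is \<open>1\<close> by induction: the size is
  entered almost surely.
\<close>

lemma prob_at_stage_sums: "n < m \<Longrightarrow> (\<lambda>k. visit_prob k n) sums (1 / p (channel n))"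
proof (induction n)
  case 0
  have "(\<lambda>k. visit_prob k 0) sums ((visit_prob 0 0 + 0) / p (channel 0))"
    by (rule affine_recurrence_sums[where g = "\<lambda>_. 0"])
       (use 0 p_pos channel_in visit_prob_step[of 0] in \<open>auto simp: visit_prob_def\<close>)
  then show ?case using 0 by (simp add: visit_prob_init)
next
  case (Suc n)
  have p: "p (channel n) > 0" using p_pos channel_in by blast
  have "(\<lambda>k. visit_prob k n * p (channel n)) sums (1 / p (channel n) * p (channel n))"
    using Suc by (intro sums_mult2) simp
  then have inflow: "(\<lambda>k. visit_prob k n * p (channel n)) sums 1"
    using p by simp
  have "(\<lambda>k. visit_prob k (Suc n)) sums ((visit_prob 0 (Suc n) + 1) / p (channel (Suc n)))"
    by (rule affine_recurrence_sums[OF _ _ inflow])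
       (use Suc.prems p p_pos channel_in visit_prob_step[OF Suc.prems] in
         \<open>auto simp: visit_prob_def intro!: mult_nonneg_nonneg less_imp_le[OF p]\<close>)
  then show ?case using Suc.prems by (simp add: visit_prob_init)
qed

section \<open>The expected transfer time\<close>

definition mean_slot_time :: "nat \<Rightarrow> real" where
  "mean_slot_time n = p (channel n) * min \<Delta> (stage n / r (channel n)) + (1 - p (channel n)) * \<Delta>"

lemma mean_slot_time_nonneg:
  assumes "n < m"
  shows "mean_slot_time n \<ge> 0"
  using assms p_pos p_le_1 channel_in[of n] channel_rate[of n] stage_pos[of n] slot_pos
  by (auto simp: mean_slot_time_def less_imp_le intro!: add_nonneg_nonneg mult_nonneg_nonneg)

text \<open>
  Only the transmission that ends the transfer can finish before its slot does.
\<close>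

lemma mean_slot_time_before_last: "Suc n < m \<Longrightarrow> mean_slot_time n = \<Delta>"
  using stage_before_last[of n] channel_rate[of n]
  by (simp add: mean_slot_time_def min_absorb1 pos_le_divide_eq algebra_simps)

lemma mean_slot_time_last:
  "mean_slot_time (m - 1) = p (channel (m - 1)) * (stage (m - 1) / r (channel (m - 1))) +
    (1 - p (channel (m - 1))) * \<Delta>"
  using stage_last channel_rate[of "m - 1"]
  by (simp add: mean_slot_time_def min_absorb2 pos_divide_le_eq)

lemma nn_integral_slot_time:
  "(\<integral>\<^sup>+ \<omega>. ennreal (slot_time \<Delta> r A \<pi> F k \<omega>) \<partial>M) =
    ennreal (\<Sum>n<m. visit_prob k n * mean_slot_time n)"
proof -
  let ?up = "\<lambda>n. {\<omega> \<in> space M. at_stage A k n \<omega> \<and> A k (channel n) \<omega>}"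
  let ?down = "\<lambda>n. {\<omega> \<in> space M. at_stage A k n \<omega> \<and> \<not> A k (channel n) \<omega>}"
  let ?t = "\<lambda>n. min \<Delta> (stage n / r (channel n))"
  let ?g = "\<lambda>\<omega>. \<Sum>n<m. ?t n * indicator (?up n) \<omega> + \<Delta> * indicator (?down n) \<omega>"
  have g: "slot_time \<Delta> r A \<pi> F k \<omega> = ?g \<omega>" if "\<omega> \<in> space M" for \<omega>
    unfolding slot_time_eq_sum using that by (intro sum.cong) auto
  have t_nonneg: "?t n \<ge> 0" if "n < m" for n
    using stage_pos[OF that] channel_rate[of n] slot_pos by simp
  have up_int: "integrable M (\<lambda>\<omega>. ?t n * indicator (?up n) \<omega>)"
    and down_int: "integrable M (\<lambda>\<omega>. \<Delta> * indicator (?down n) \<omega>)" if "n < m" for n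
    using that by (auto intro!: integrable_mult_right simp: emeasure_eq_measure)
  have expect_slot:
    "expectation (\<lambda>\<omega>. ?t n * indicator (?up n) \<omega> + \<Delta> * indicator (?down n) \<omega>) =
      ?t n * prob (?up n) + \<Delta> * prob (?down n)" if "n < m" for n
    by (subst Bochner_Integration.integral_add[OF up_int[OF that] down_int[OF that]])
       (simp add: Int_absorb2 Collect_restrict)
  have "(\<integral>\<^sup>+ \<omega>. ennreal (slot_time \<Delta> r A \<pi> F k \<omega>) \<partial>M) = (\<integral>\<^sup>+ \<omega>. ennreal (?g \<omega>) \<partial>M)"
    by (intro nn_integral_cong) (simp only: g)
  also have "\<dots> = ennreal (expectation ?g)"
    using t_nonneg slot_pos
    by (intro nn_integral_eq_integral AE_I2 sum_nonneg add_nonneg_nonneg mult_nonneg_nonneg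
        Bochner_Integration.integrable_sum Bochner_Integration.integrable_add up_int down_int)
       auto
  also have "expectation ?g = (\<Sum>n<m. ?t n * prob (?up n) + \<Delta> * prob (?down n))"
    by (subst Bochner_Integration.integral_sum)
       (intro Bochner_Integration.integrable_add up_int down_int sum.cong refl expect_slot;
        simp only: lessThan_iff)+
  also have "\<dots> = (\<Sum>n<m. visit_prob k n * mean_slot_time n)"
    by (intro sum.cong)
       (auto simp: prob_at_stage_available prob_at_stage_unavailable mean_slot_time_def algebra_simps)
  finally show ?thesis .
qed

lemma slot_time_measurable [measurable]: "(\<lambda>\<omega>. slot_time \<Delta> r A \<pi> F k \<omega>) \<in> borel_measurable M"
  unfolding slot_time_eq_sum by (intro borel_measurable_sum) simp

lemma nn_integral_transfer_time:
  "(\<integral>\<^sup>+ \<omega>. transfer_time \<Delta> r A \<pi> F \<omega> \<partial>M) = ennreal (\<Sum>n<m. mean_slot_time n / p (channel n))"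
proof -
  have "(\<lambda>k. \<Sum>n<m. visit_prob k n * mean_slot_time n) sums
      (\<Sum>n<m. 1 / p (channel n) * mean_slot_time n)"
    by (intro sums_sum sums_mult2 prob_at_stage_sums) simp
  moreover have "(\<Sum>n<m. visit_prob k n * mean_slot_time n) \<ge> 0" for k
    by (intro sum_nonneg mult_nonneg_nonneg mean_slot_time_nonneg) (auto simp: visit_prob_def)
  ultimately have "(\<Sum>k. ennreal (\<Sum>n<m. visit_prob k n * mean_slot_time n)) =
      ennreal (\<Sum>n<m. 1 / p (channel n) * mean_slot_time n)"
    by (intro suminf_ennreal_eq)
  then show ?thesis
    unfolding transfer_time_def
    by (subst nn_integral_suminf) (simp_all add: nn_integral_slot_time)
qed

lemma sum_mean_slot_time:
  "(\<Sum>n<m. mean_slot_time n / p (channel n)) =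
    \<Delta> * ((\<Sum>n<m - 1. 1 / p (channel n)) + (1 - p (channel (m - 1))) / p (channel (m - 1))) +
      stage (m - 1) / r (channel (m - 1))"
proof -
  have p: "p (channel (m - 1)) > 0" using p_pos channel_in by blast
  have "{..<m} = insert (m - 1) {..<m - 1}" using m_pos by auto
  then have "(\<Sum>n<m. mean_slot_time n / p (channel n)) =
      mean_slot_time (m - 1) / p (channel (m - 1)) + (\<Sum>n<m - 1. mean_slot_time n / p (channel n))"
    by simp
  also have "(\<Sum>n<m - 1. mean_slot_time n / p (channel n)) = \<Delta> * (\<Sum>n<m - 1. 1 / p (channel n))"
    unfolding sum_distrib_left by (intro sum.cong) (auto simp: mean_slot_time_before_last)
  also have "mean_slot_time (m - 1) / p (channel (m - 1)) =
      stage (m - 1) / r (channel (m - 1)) + \<Delta> * ((1 - p (channel (m - 1))) / p (channel (m - 1)))"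
    unfolding mean_slot_time_last using p by (simp add: add_divide_distrib)
  finally show ?thesis by (simp add: distrib_left)
qed

end

theorem proposition4p1:
  fixes M :: "'w measure" and N :: nat and \<Delta> F :: real and r p :: "nat \<Rightarrow> real"
    and A :: "nat \<Rightarrow> nat \<Rightarrow> 'w \<Rightarrow> bool" and \<pi> :: "real \<Rightarrow> nat"
  assumes "prob_space M"
    and "\<Delta> > 0"
    and "\<And>i. i \<in> {1..N} \<Longrightarrow> r i > 0"
    and "\<And>i. i \<in> {1..N} \<Longrightarrow> 0 < p i \<and> p i \<le> 1"
    and "prob_space.indep_vars M (\<lambda>_. count_space UNIV) (\<lambda>(k, i). A k i) (UNIV \<times> {1..N})"
    and "\<And>k i. i \<in> {1..N} \<Longrightarrow> measure M {\<omega> \<in> space M. A k i \<omega>} = p i"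
    and "F > 0"
    and "\<pi> \<in> policies N"
  shows "(\<integral>\<^sup>+ \<omega>. transfer_time \<Delta> r A \<pi> F \<omega> \<partial>M) =
    (let m = num_transmissions \<Delta> r \<pi> F; f = size_before \<Delta> r \<pi> F in
     ennreal (\<Delta> * ((\<Sum>n = 1..m - 1. 1 / p (\<pi> (f n))) + (1 - p (\<pi> (f m))) / p (\<pi> (f m)))
              + f m / r (\<pi> (f m))))"
proof -
  interpret random_file_transfer \<Delta> F r \<pi> N M p A
    using assms
    by (intro random_file_transfer.intro file_transfer.intro random_file_transfer_axioms.intro) auto
  \<comment> \<open>The sizes \<open>F\<^sub>1, \<dots>, F\<^sub>m\<close> are numbered from \<open>1\<close>, the stages from \<open>0\<close>.\<close>
  have f: "size_before \<Delta> r \<pi> F (Suc n) = stage n" if "n < m" for n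
    using size_before_eq_transmit(1)[OF file_pos that] by (simp add: stage_def)
  have last: "size_before \<Delta> r \<pi> F m = stage (m - 1)"
    using f[of "m - 1"] m_pos by simp
  have "(\<Sum>n = 1..m - 1. 1 / p (\<pi> (size_before \<Delta> r \<pi> F n))) =
      (\<Sum>n<m - 1. 1 / p (\<pi> (size_before \<Delta> r \<pi> F (Suc n))))"
    by (rule sum.reindex_bij_witness[of _ Suc "\<lambda>n. n - 1"]) auto
  also have "\<dots> = (\<Sum>n<m - 1. 1 / p (channel n))"
    by (intro sum.cong) (auto simp: f channel_def)
  finally show ?thesis
    unfolding Let_def last nn_integral_transfer_time sum_mean_slot_time by (simp add: channel_def)
qed

end
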